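(* Suppose $p,q,r$ satisfy $1<q<2<p<\infty$ and $1/r=1/q-1/p$. Let $\alpha,\beta\in(0,1)$ be such that $$\frac12<\frac\beta q<\frac\alpha{p'}<\frac1q<1.$$ Let $U(y)=(|y|+1)^{\beta-1}$ for $y\in\mathbb R$ and $W(x)=|x|^{(1-\alpha)(p-1)}$ for $x\in\mathbb R$. Define $u$ and $w$ on $(0,\infty)$ by $u=U^*$ and $1/w=(1/W)^*$. Then $$\bigg(\int_0^\infty\bigg(\int_0^x u\bigg)^{r/p}\bigg(\int_0^{1/x}w^{1-p'}\bigg)^{r/p'}u(x)\,dx\bigg)^{1/r}<\infty,$$ but there is no finite constant $C$ such that $$\bigg(\int_{\mathbb R}|\hat f(y)|^qU(y)\,dy\bigg)^{1/q}\le C\bigg(\int_{\mathbb R}|f(x)|^pW(x)\,dx\bigg)^{1/p}$$ for all $f\in L^1(\mathbb R)$.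
   Context: The Fourier transform of $f\in L^1(\mathbb R)$ is $\hat f(x)=\int_{\mathbb R}e^{-2\pi i xy}f(y)\,dy$. For a measurable function $f$ on $\mathbb R$, with $\mu$ denoting Lebesgue measure, the non-increasing rearrangement is $f^*(t)=\inf\{\alpha>0:\mu_f(\alpha)\le t\}$, $t>0$, where $\mu_f(\alpha)=\mu\{x:|f(x)|>\alpha\}$. Conjugate indices: $1/p+1/p'=1$. *)

theory Defs
  imports "HOL-Analysis.Analysis"
begin

definition fourier :: "(real \<Rightarrow> complex) \<Rightarrow> real \<Rightarrow> complex" where
  "fourier f x = (LINT y|lebesgue. exp (- 2 * of_real pi * \<i> * of_real x * of_real y) * f y)"

definition distribution_function :: "(real \<Rightarrow> real) \<Rightarrow> real \<Rightarrow> ennreal" where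
  "distribution_function f a = emeasure lebesgue {x. \<bar>f x\<bar> > a}"

(* Extended-valued: the infimum of the empty set of levels is infinity. *)
definition rearrangement :: "(real \<Rightarrow> real) \<Rightarrow> real \<Rightarrow> ennreal" where
  "rearrangement f t = (INF a\<in>{a. a > 0 \<and> distribution_function f a \<le> ennreal t}. ennreal a)"

(* Powers of extended nonnegative reals with an arbitrary real exponent, where a
   negative power of 0 is infinity and a negative power of infinity is 0. *)
definition epowr :: "ennreal \<Rightarrow> real \<Rightarrow> ennreal"  (infixr "epowr" 80) where
  "x epowr s =
    (if s = 0 then 1
     else if x = 0 then (if s < 0 then \<infinity> else 0)
     else if x = \<infinity> then (if s < 0 then 0 else \<infinity>)
     else ennreal (enn2real x powr s))"

end

(*
  The integral condition only involves majorants by pure powers: u(t) is at most both 1 and a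
  multiple of t^(\<beta>-1), and w(t)^(1-p') is at most a multiple of t^(\<alpha>-1). Near 0 the integrand is
  then integrable because \<alpha>/p' < 1/q, near infinity because \<beta>/q < \<alpha>/p'.

  The norm inequality is refuted by Rudin-Shapiro step functions on [0,1): starting with
  f = g = 1, replace the pair (f, g) by the two concatenations of f with g and with -g, each
  compressed to half length. All these functions have modulus 1, so the right-hand side stays
  bounded. The parallelogram law shows that after k steps the sum of the squared moduli of the
  two transforms is its initial value at y / 2^k, divided by 2^k; hence at every frequency of
  size up to about 2^k one of the two has modulus at least of order 2^(-k/2). The q-th powers of
  the two left-hand sides then add up to at least a multiple of 2^(k(\<beta> - q/2)), which is
  unbounded as \<beta>/q > 1/2.
*)

theory Submission
  imports Defs
begin

section \<open>Real powers of extended nonnegative reals\<close>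

lemma epowr_mono: "0 < s \<Longrightarrow> x \<le> y \<Longrightarrow> x epowr s \<le> y epowr s"
  by (auto simp: epowr_def top_unique less_top intro!: ennreal_leI powr_mono2 enn2real_mono)

lemma epowr_ennreal: "0 < s \<Longrightarrow> 0 \<le> a \<Longrightarrow> ennreal a epowr s = ennreal (a powr s)"
  by (auto simp: epowr_def)

lemma epowr_less_top: "0 < s \<Longrightarrow> x < \<infinity> \<Longrightarrow> x epowr s < \<infinity>"
  by (auto simp: epowr_def)

text \<open>The rearrangement hypothesis controls \<open>1 / w\<close>, whereas the integral
  contains a negative power of \<open>w\<close>; this converts one into the other. The extreme
  values fit because \<open>1 / 0\<close> is infinity and \<open>1 / \<infinity>\<close> is 0 here,
  matching the conventions in \<open>epowr\<close>.\<close>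

lemma epowr_minus: "0 < s \<Longrightarrow> x epowr (- s) = (1 / x) epowr s"
proof (cases x)
  case (real a)
  then show "0 < s \<Longrightarrow> ?thesis"
    by (cases "a = 0")
       (auto simp: epowr_def powr_minus powr_divide divide_ennreal ennreal_divide_eq_0_iff
          ennreal_1[symmetric] inverse_eq_divide simp del: ennreal_1)
qed (auto simp: epowr_def)

lemma le_of_epowr_le:
  assumes "0 < s" "0 \<le> c" "x epowr s \<le> ennreal c"
  shows "x \<le> ennreal (c powr (1 / s))"
proof (cases x)
  case (real a)
  then have "a powr s \<le> c"
    using assms by (simp add: epowr_ennreal)
  then have "(a powr s) powr (1 / s) \<le> c powr (1 / s)"
    using assms by (intro powr_mono2) auto
  then show ?thesis using real assms by (simp add: powr_powr)
next
  case top
  then show ?thesis using assms by (simp add: epowr_def top_unique)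
qed

section \<open>Power majorants for rearrangements and finiteness of the integral\<close>

text \<open>The superlevel set at height \<open>a\<close> is trapped in a centred interval of length
  \<open>t\<close>, so \<open>a\<close> is an admissible level in the infimum. One-sided bounds
  suffice below, so no rearrangement is ever computed exactly.\<close>

lemma rearrangement_le_of_level:
  assumes "0 < a" "0 \<le> t" "\<And>x. t / 2 < \<bar>x\<bar> \<Longrightarrow> \<bar>f x\<bar> \<le> a"
  shows "rearrangement f t \<le> ennreal a"
proof -
  have "{x. a < \<bar>f x\<bar>} \<subseteq> {- (t / 2)..t / 2}"
  proof
    fix x assume "x \<in> {x. a < \<bar>f x\<bar>}"
    then have "\<not> t / 2 < \<bar>x\<bar>" using assms(3)[of x] by auto
    then show "x \<in> {- (t / 2)..t / 2}" by auto
  qed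
  then have "distribution_function f a \<le> emeasure lebesgue {- (t / 2)..t / 2}"
    unfolding distribution_function_def by (intro emeasure_mono) auto
  also have "\<dots> = ennreal t" using assms(2) by simp
  finally show ?thesis
    unfolding rearrangement_def using assms(1) by (intro INF_lower) auto
qed

lemma nn_integral_powr_from_0_le:
  assumes "-1 < a" "0 \<le> c" "0 \<le> K" "\<And>t. 0 < t \<Longrightarrow> t < c \<Longrightarrow> f t \<le> ennreal (K * t powr a)"
  shows "(\<integral>\<^sup>+t\<in>{0<..<c}. f t \<partial>lebesgue) \<le> ennreal (K * (c powr (a + 1) / (a + 1)))"
proof -
  have "((\<lambda>t. K * t powr a) has_integral K * (c powr (a + 1) / (a + 1))) {0..c}"
    by (intro has_integral_mult_right has_integral_powr_from_0 assms)
  then have "(\<integral>\<^sup>+t. ennreal (K * t powr a) * indicator {0..c} t \<partial>lborel)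
      = ennreal (K * (c powr (a + 1) / (a + 1)))"
    by (rule nn_integral_has_integral_lebesgue'[rotated]) (use assms in auto)
  moreover have "(\<integral>\<^sup>+t\<in>{0<..<c}. f t \<partial>lebesgue)
      \<le> (\<integral>\<^sup>+t. ennreal (K * t powr a) * indicator {0..c} t \<partial>lebesgue)"
    using assms(4) by (intro nn_integral_mono) (auto simp: indicator_def)
  ultimately show ?thesis by (simp add: nn_integral_completion)
qed

text \<open>No single power is integrable on the whole half-line, hence one majorant with exponent
  above -1 up to 1 and another with exponent below -1 beyond it.\<close>

lemma nn_integral_Ioi_finite_of_powr_bounds:
  assumes "-1 < a" "b < -1" "0 \<le> K" "0 \<le> L"
    and "\<And>x. 0 < x \<Longrightarrow> x \<le> 1 \<Longrightarrow> f x \<le> ennreal (K * x powr a)"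
    and "\<And>x. 1 < x \<Longrightarrow> f x \<le> ennreal (L * x powr b)"
  shows "(\<integral>\<^sup>+x\<in>{0<..}. f x \<partial>lebesgue) < \<infinity>"
proof -
  have "((\<lambda>x. K * x powr a) has_integral K * (1 powr (a + 1) / (a + 1))) {0..1}"
    by (intro has_integral_mult_right has_integral_powr_from_0 assms) simp
  then have 1: "(\<integral>\<^sup>+x. ennreal (K * x powr a) * indicator {0..1} x \<partial>lborel)
      = ennreal (K * (1 powr (a + 1) / (a + 1)))"
    by (rule nn_integral_has_integral_lebesgue'[rotated]) (use assms in auto)
  have "((\<lambda>x. L * x powr b) has_integral L * (- (1 powr (b + 1)) / (b + 1))) {1..}"
    by (intro has_integral_mult_right has_integral_powr_to_inf assms) simp
  then have 2: "(\<integral>\<^sup>+x. ennreal (L * x powr b) * indicator {1..} x \<partial>lborel)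
      = ennreal (L * (- (1 powr (b + 1)) / (b + 1)))"
    by (rule nn_integral_has_integral_lebesgue'[rotated]) (use assms in auto)
  have "(\<integral>\<^sup>+x\<in>{0<..}. f x \<partial>lebesgue)
      \<le> (\<integral>\<^sup>+x. ennreal (K * x powr a) * indicator {0..1} x
              + ennreal (L * x powr b) * indicator {1..} x \<partial>lebesgue)"
  proof (rule nn_integral_mono)
    fix x :: real
    show "f x * indicator {0<..} x
      \<le> ennreal (K * x powr a) * indicator {0..1} x + ennreal (L * x powr b) * indicator {1..} x"
      using assms(5)[of x] assms(6)[of x]
      by (cases "x \<le> 1") (auto simp: indicator_def intro: add_increasing2)
  qed
  also have "\<dots> = (\<integral>\<^sup>+x. ennreal (K * x powr a) * indicator {0..1} x \<partial>lborel)
              + (\<integral>\<^sup>+x. ennreal (L * x powr b) * indicator {1..} x \<partial>lborel)"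
    unfolding nn_integral_completion by (rule nn_integral_add) auto
  also have "\<dots> < \<infinity>" unfolding 1 2 by simp
  finally show ?thesis .
qed

lemma rearrangement_integral_finite:
  fixes p q r p' \<alpha> \<beta> :: real and u w :: "real \<Rightarrow> ennreal"
  assumes pqr: "0 < q" "q < p" "1 < p" "1 / r = 1 / q - 1 / p" "1 / p + 1 / p' = 1"
    and \<alpha>: "0 < \<alpha>" "\<alpha> < 1" and \<beta>: "0 < \<beta>" "\<beta> < 1"
    and exps: "\<beta> / q < \<alpha> / p'" "\<alpha> / p' < 1 / q"
    and u: "\<And>t. 0 < t \<Longrightarrow> u t = rearrangement (\<lambda>y. (\<bar>y\<bar> + 1) powr (\<beta> - 1)) t"
    and w: "\<And>t. 0 < t \<Longrightarrow>
      1 / w t = rearrangement (\<lambda>x. 1 / \<bar>x\<bar> powr ((1 - \<alpha>) * (p - 1))) t"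
  shows "(\<integral>\<^sup>+x\<in>{0<..}.
             (\<integral>\<^sup>+t\<in>{0<..<x}. u t \<partial>lebesgue) epowr (r / p) *
             (\<integral>\<^sup>+t\<in>{0<..<1 / x}. (w t) epowr (1 - p') \<partial>lebesgue) epowr (r / p') *
             u x \<partial>lebesgue) < \<infinity>"
proof -
  define \<gamma> where "\<gamma> = (1 - \<alpha>) * (p - 1)"
  have p': "p' = p / (p - 1)" "1 < p'"
  proof -
    have "1 / p' = (p - 1) / p" using pqr by (simp add: field_simps)
    then show "p' = p / (p - 1)" by (metis inverse_divide inverse_eq_divide inverse_inverse_eq div_by_1)
    then show "1 < p'" using pqr by simp
  qed
  have "1 / p < 1 / q" using pqr by (intro divide_strict_left_mono) auto
  then have r: "0 < r" using pqr(4) by (metis diff_gt_0_iff_gt zero_less_divide_1_iff)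
  have \<gamma>: "0 < \<gamma>" using pqr \<alpha> by (simp add: \<gamma>_def)
  \<comment> \<open>Conjugacy gives (p - 1)(p' - 1) = 1. This turns decay of order
    \<open>t powr (- \<gamma>)\<close> for \<open>1 / w\<close> into the order
    \<open>t powr (\<alpha> - 1)\<close> for \<open>w t epowr (1 - p')\<close>, which is integrable
    at 0.\<close>
  have \<gamma>p': "\<gamma> * (p' - 1) = 1 - \<alpha>" using pqr by (simp add: \<gamma>_def p' field_simps)

  \<comment> \<open>Both bounds on \<open>u\<close> are used: the power bound \<open>u2\<close>
    governs large arguments, but near 0 it would produce the same exponent below -1 and a divergent
    majorant, so the constant bound takes over there.\<close>
  have u1: "u t \<le> ennreal 1" if "0 < t" for t
    unfolding u[OF that]
  proof (rule rearrangement_le_of_level)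
    fix y :: real
    show "\<bar>(\<bar>y\<bar> + 1) powr (\<beta> - 1)\<bar> \<le> 1"
      using powr_mono2'[of "\<beta> - 1" 1 "\<bar>y\<bar> + 1"] \<beta> by simp
  qed (use that in auto)
  have u2: "u t \<le> ennreal (2 powr (1 - \<beta>) * t powr (\<beta> - 1))" if "0 < t" for t
  proof -
    have "u t \<le> ennreal ((t / 2) powr (\<beta> - 1))"
      unfolding u[OF that] using that \<beta>
      by (intro rearrangement_le_of_level) (auto intro!: powr_mono2')
    also have "(t / 2) powr (\<beta> - 1) = 2 powr (1 - \<beta>) * t powr (\<beta> - 1)"
      using that by (simp add: powr_divide powr_diff)
    finally show ?thesis .
  qed
  have w1: "w t epowr (1 - p') \<le> ennreal (2 powr (1 - \<alpha>) * t powr (\<alpha> - 1))" if "0 < t" for t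
  proof -
    have "1 / w t \<le> ennreal ((t / 2) powr (- \<gamma>))"
      unfolding w[OF that] \<gamma>_def[symmetric] using that \<gamma>
      by (intro rearrangement_le_of_level)
         (auto intro!: powr_mono2 divide_left_mono simp: powr_minus_divide)
    then have "(1 / w t) epowr (p' - 1) \<le> ennreal ((t / 2) powr (- \<gamma>)) epowr (p' - 1)"
      using p' by (intro epowr_mono) auto
    also have "\<dots> = ennreal ((t / 2) powr (\<alpha> - 1))"
      using p' \<gamma>p' by (subst epowr_ennreal) (auto simp: powr_powr)
    also have "(t / 2) powr (\<alpha> - 1) = 2 powr (1 - \<alpha>) * t powr (\<alpha> - 1)"
      using that by (simp add: powr_divide powr_diff)
    finally show ?thesis
      using epowr_minus[of "p' - 1" "w t"] p' by simp
  qed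

  define c d where "c = 2 powr (1 - \<beta>) / \<beta>" and "d = 2 powr (1 - \<alpha>) / \<alpha>"
  have cd: "0 < c" "0 < d" using \<alpha> \<beta> by (auto simp: c_def d_def)
  have I1: "(\<integral>\<^sup>+t\<in>{0<..<x}. u t \<partial>lebesgue) epowr (r / p) \<le> ennreal (x powr (r / p))" if "0 < x" for x
  proof -
    have "(\<integral>\<^sup>+t\<in>{0<..<x}. u t \<partial>lebesgue) \<le> ennreal (1 * (x powr (0 + 1) / (0 + 1)))"
      using that u1 by (intro nn_integral_powr_from_0_le) auto
    then have "(\<integral>\<^sup>+t\<in>{0<..<x}. u t \<partial>lebesgue) epowr (r / p) \<le> ennreal x epowr (r / p)"
      using that r pqr by (intro epowr_mono) auto
    also have "\<dots> = ennreal (x powr (r / p))"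
      using that r pqr by (intro epowr_ennreal) auto
    finally show ?thesis .
  qed
  have I2: "(\<integral>\<^sup>+t\<in>{0<..<x}. u t \<partial>lebesgue) epowr (r / p)
      \<le> ennreal (c powr (r / p) * x powr (\<beta> * (r / p)))" if "0 < x" for x
  proof -
    have "(\<integral>\<^sup>+t\<in>{0<..<x}. u t \<partial>lebesgue)
        \<le> ennreal (2 powr (1 - \<beta>) * (x powr (\<beta> - 1 + 1) / (\<beta> - 1 + 1)))"
      using that u2 \<beta> by (intro nn_integral_powr_from_0_le) auto
    then have "(\<integral>\<^sup>+t\<in>{0<..<x}. u t \<partial>lebesgue) epowr (r / p) \<le> ennreal (c * x powr \<beta>) epowr (r / p)"
      using that r pqr by (intro epowr_mono) (auto simp: c_def)
    also have "\<dots> = ennreal (c powr (r / p) * x powr (\<beta> * (r / p)))"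
      using that r pqr cd by (subst epowr_ennreal) (auto simp: powr_mult powr_powr)
    finally show ?thesis .
  qed
  have J: "(\<integral>\<^sup>+t\<in>{0<..<1 / x}. w t epowr (1 - p') \<partial>lebesgue) epowr (r / p')
      \<le> ennreal (d powr (r / p') * x powr (- \<alpha> * (r / p')))" if "0 < x" for x
  proof -
    have "(\<integral>\<^sup>+t\<in>{0<..<1 / x}. w t epowr (1 - p') \<partial>lebesgue)
        \<le> ennreal (2 powr (1 - \<alpha>) * ((1 / x) powr (\<alpha> - 1 + 1) / (\<alpha> - 1 + 1)))"
      using that w1 \<alpha> by (intro nn_integral_powr_from_0_le) auto
    also have "2 powr (1 - \<alpha>) * ((1 / x) powr (\<alpha> - 1 + 1) / (\<alpha> - 1 + 1)) = d * x powr (- \<alpha>)"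
      using that by (simp add: d_def powr_divide powr_minus_divide)
    finally have "(\<integral>\<^sup>+t\<in>{0<..<1 / x}. w t epowr (1 - p') \<partial>lebesgue) epowr (r / p')
        \<le> ennreal (d * x powr (- \<alpha>)) epowr (r / p')"
      using that r p'(2) by (intro epowr_mono) auto
    also have "\<dots> = ennreal (d powr (r / p') * x powr (- \<alpha> * (r / p')))"
      using that r p'(2) cd by (subst epowr_ennreal) (auto simp: powr_mult powr_powr)
    finally show ?thesis .
  qed
  \<comment> \<open>This identity turns the exponent tests into the hypotheses. Near 0, r/p -
    \<alpha> r/p' > -1 says \<alpha>/p' < 1/q; near infinity, \<beta> r/p - \<alpha> r/p' + \<beta>
    - 1 < -1 says \<beta>/q < \<alpha>/p'.\<close>
  have rq: "r / p + 1 = r / q"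
    using pqr(4) r pqr by (simp add: field_simps)
  show ?thesis
  proof (rule nn_integral_Ioi_finite_of_powr_bounds)
    have "\<alpha> / p' * r < 1 / q * r" using exps r by (intro mult_strict_right_mono)
    then show "-1 < r / p + - \<alpha> * (r / p')" using rq by (simp add: algebra_simps)
    have "\<beta> / q * r < \<alpha> / p' * r" using exps r by (intro mult_strict_right_mono)
    moreover have "\<beta> / q * r = \<beta> * (r / p) + \<beta>"
      using arg_cong[OF rq, of "\<lambda>x. \<beta> * x"] by (simp add: algebra_simps)
    ultimately show "\<beta> * (r / p) + - \<alpha> * (r / p') + (\<beta> - 1) < -1" by (simp add: algebra_simps)
  next
    fix x :: real assume x: "0 < x" "x \<le> 1"
    have "(\<integral>\<^sup>+t\<in>{0<..<x}. u t \<partial>lebesgue) epowr (r / p) *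
          (\<integral>\<^sup>+t\<in>{0<..<1 / x}. w t epowr (1 - p') \<partial>lebesgue) epowr (r / p') * u x
       \<le> ennreal (x powr (r / p)) * ennreal (d powr (r / p') * x powr (- \<alpha> * (r / p'))) * ennreal 1"
      using x by (intro mult_mono I1 J u1) auto
    also have "\<dots> = ennreal (d powr (r / p') * x powr (r / p + - \<alpha> * (r / p')))"
      unfolding powr_add by (simp add: mult_ac flip: ennreal_mult)
    finally show "(\<integral>\<^sup>+t\<in>{0<..<x}. u t \<partial>lebesgue) epowr (r / p) *
          (\<integral>\<^sup>+t\<in>{0<..<1 / x}. w t epowr (1 - p') \<partial>lebesgue) epowr (r / p') * u x \<le> \<dots>" .
  next
    fix x :: real assume x: "1 < x"
    have "(\<integral>\<^sup>+t\<in>{0<..<x}. u t \<partial>lebesgue) epowr (r / p) *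
          (\<integral>\<^sup>+t\<in>{0<..<1 / x}. w t epowr (1 - p') \<partial>lebesgue) epowr (r / p') * u x
       \<le> ennreal (c powr (r / p) * x powr (\<beta> * (r / p)))
        * ennreal (d powr (r / p') * x powr (- \<alpha> * (r / p')))
        * ennreal (2 powr (1 - \<beta>) * x powr (\<beta> - 1))"
      using x by (intro mult_mono I2 J u2) auto
    also have "\<dots> = ennreal (c powr (r / p) * d powr (r / p') * 2 powr (1 - \<beta>)
        * x powr (\<beta> * (r / p) + - \<alpha> * (r / p') + (\<beta> - 1)))"
      unfolding powr_add by (simp add: mult_ac flip: ennreal_mult)
    finally show "(\<integral>\<^sup>+t\<in>{0<..<x}. u t \<partial>lebesgue) epowr (r / p) *
          (\<integral>\<^sup>+t\<in>{0<..<1 / x}. w t epowr (1 - p') \<partial>lebesgue) epowr (r / p') * u x \<le> \<dots>" .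
  qed auto
qed

section \<open>Fourier transforms of functions dominated by the indicator of [0,1)\<close>

text \<open>A chord of the unit circle is no longer than its arc: factoring out one exponential
  leaves a chord of length 2 |sin((a - b)/2)|.\<close>

lemma norm_exp_i_diff_le:
  fixes a b :: real
  shows "norm (exp (\<i> * of_real a) - exp (\<i> * of_real b)) \<le> \<bar>a - b\<bar>"
proof -
  have "exp (\<i> * of_real a) - exp (\<i> * of_real b)
      = exp (\<i> * of_real b) * (exp (\<i> * of_real (a - b)) - 1)"
    by (simp add: algebra_simps flip: exp_add)
  hence "norm (exp (\<i> * of_real a) - exp (\<i> * of_real b)) = 2 * \<bar>sin ((a - b) / 2)\<bar>"
    by (simp only: norm_mult norm_exp_i_times dist_exp_i_1)
  also have "\<dots> \<le> \<bar>a - b\<bar>"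
    using abs_sin_x_le_abs_x[of "(a - b) / 2"] by simp
  finally show ?thesis .
qed

text \<open>For Borel functions the integral can be taken over \<open>lborel\<close>, where the
  affine substitution rule applies. Writing the exponent as \<i> times a real number exhibits the
  kernel as unimodular.\<close>

lemma fourier_lborel:
  assumes [measurable]: "f \<in> borel_measurable borel"
  shows "fourier f y = (LINT x|lborel. exp (\<i> * of_real (- 2 * pi * y * x)) * f x)"
  unfolding fourier_def
  by (subst integral_completion) (auto simp: mult_ac)

lemma integrable_character_mult:
  fixes f :: "real \<Rightarrow> complex"
  assumes "integrable lborel f"
  shows "integrable lborel (\<lambda>x. exp (\<i> * of_real (a * x)) * f x)"
proof (rule Bochner_Integration.integrable_bound[OF assms])
  show "(\<lambda>x. exp (\<i> * of_real (a * x)) * f x) \<in> borel_measurable lborel"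
    using assms by measurable
qed (auto simp: norm_mult simp del: of_real_mult)

lemma integrable_of_bounded_unit_support:
  fixes f :: "real \<Rightarrow> complex"
  assumes "f \<in> borel_measurable borel" "\<And>x. norm (f x) \<le> indicator {0..<1} x"
  shows "integrable lborel f"
  by (rule Bochner_Integration.integrable_bound[where f = "indicator {0..<1} :: real \<Rightarrow> real"])
     (use assms in \<open>auto\<close>)

text \<open>The chord bound for the kernels carries a factor |x|, which is at most 1 on the support.
  The estimate serves twice: for the lower bound near frequency 0, and for continuity, hence
  measurability, of the transforms.\<close>

lemma fourier_lipschitz:
  fixes f :: "real \<Rightarrow> complex"
  assumes [measurable]: "f \<in> borel_measurable borel"
    and bd: "\<And>x. norm (f x) \<le> indicator {0..<1} x"
  shows "norm (fourier f y - fourier f z) \<le> 2 * pi * \<bar>y - z\<bar>"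
proof -
  note int = integrable_character_mult[OF integrable_of_bounded_unit_support[OF assms]]
  have "fourier f y - fourier f z
      = (LINT x|lborel. exp (\<i> * of_real (- 2 * pi * y * x)) * f x
                      - exp (\<i> * of_real (- 2 * pi * z * x)) * f x)"
    unfolding fourier_lborel[OF assms(1)] by (rule Bochner_Integration.integral_diff[symmetric]; rule int)
  also have "norm \<dots> \<le> (LINT (x::real)|lborel. 2 * pi * \<bar>y - z\<bar> * indicator {0..<1} x)"
  proof (rule Bochner_Integration.integral_norm_bound_integral)
    fix x :: real
    have "norm (exp (\<i> * of_real (- 2 * pi * y * x)) * f x - exp (\<i> * of_real (- 2 * pi * z * x)) * f x)
       = norm (exp (\<i> * of_real (- 2 * pi * y * x)) - exp (\<i> * of_real (- 2 * pi * z * x))) * norm (f x)"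
      by (simp add: norm_mult left_diff_distrib flip: norm_mult)
    also have "\<dots> \<le> \<bar>- 2 * pi * y * x - (- 2 * pi * z * x)\<bar> * indicator {0..<1} x"
      by (rule mult_mono[OF norm_exp_i_diff_le bd]) auto
    also have "- 2 * pi * y * x - (- 2 * pi * z * x) = 2 * pi * (z - y) * x"
      by (simp add: algebra_simps)
    also have "\<bar>2 * pi * (z - y) * x\<bar> * indicator {0..<1} x \<le> 2 * pi * \<bar>y - z\<bar> * indicator {0..<1} x"
      by (auto simp: indicator_def abs_mult abs_minus_commute mult_left_le)
    finally show "norm (exp (\<i> * of_real (- 2 * pi * y * x)) * f x - exp (\<i> * of_real (- 2 * pi * z * x)) * f x)
      \<le> 2 * pi * \<bar>y - z\<bar> * indicator {0..<1} x" .
  qed (intro Bochner_Integration.integrable_diff int, auto)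
  finally show ?thesis by simp
qed

text \<open>The transform equals 1 at frequency 0 and has Lipschitz constant 2 pi < 8, so it can
  drop by at most 8/16 = 1/2 on this range; this is the origin of 1/16.\<close>

lemma fourier_unit_indicator_ge:
  assumes "\<bar>y\<bar> \<le> 1 / 16"
  shows "1 / 2 \<le> norm (fourier (indicator {0..<1}) y)"
proof -
  have 0: "fourier (indicator {0..<1}) 0 = 1"
  proof -
    have "fourier (indicator {0..<1}) 0 = (LINT (x::real)|lborel. complex_of_real (indicator {0..<1} x))"
      by (subst fourier_lborel) (auto simp: of_real_indicator)
    also have "\<dots> = 1" by simp
    finally show ?thesis .
  qed
  have "norm (fourier (indicator {0..<1}) y - fourier (indicator {0..<1}) 0) \<le> 2 * pi * \<bar>y - 0\<bar>"
    by (rule fourier_lipschitz) (auto simp: indicator_def)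
  also have "\<dots> \<le> 2 * 4 * (1/16)"
    using assms pi_less_4 by (intro mult_mono) auto
  finally show ?thesis
    unfolding 0 using norm_triangle_ineq2[of 1 "fourier (indicator {0..<1}) y"]
    by (simp add: norm_minus_commute)
qed

lemma fourier_continuous_on:
  fixes f :: "real \<Rightarrow> complex"
  assumes "f \<in> borel_measurable borel" "\<And>x. norm (f x) \<le> indicator {0..<1} x"
  shows "continuous_on UNIV (fourier f)"
  by (rule lipschitz_on_continuous_on[where L = "2 * pi"], rule lipschitz_onI)
     (use fourier_lipschitz[OF assms] in \<open>auto simp: dist_norm\<close>)

text \<open>Compression to half length halves both the frequency and the amplitude; shifting the
  second piece by 1/2 contributes the unimodular phase
  \<open>exp (\<i> * of_real (- pi * y))\<close>. The sign choices below are \<open>c = 1\<close>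
  and \<open>c = - 1\<close>.\<close>

lemma fourier_concat:
  fixes f g :: "real \<Rightarrow> complex" and c :: complex
  assumes [measurable]: "f \<in> borel_measurable borel" "g \<in> borel_measurable borel"
    and int: "integrable lborel f" "integrable lborel g"
  shows "fourier (\<lambda>x. f (2 * x) + c * g (2 * x - 1)) y
    = (fourier f (y / 2) + c * exp (\<i> * of_real (- pi * y)) * fourier g (y / 2)) / 2"
proof -
  \<comment> \<open>Both pieces are handled at once, with \<open>s = 0\<close> for the left half and
    \<open>s = 1\<close> for the right half, by substituting s/2 + x/2 for x.\<close>
  have dilate: "integrable lborel (\<lambda>x. exp (\<i> * of_real (a * x)) * h (2 * x - s))
      \<and> (LINT x|lborel. exp (\<i> * of_real (- 2 * pi * y * x)) * h (2 * x - s))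
       = exp (\<i> * of_real (- pi * y * s)) * fourier h (y / 2) / 2"
    if [measurable]: "h \<in> borel_measurable borel" and h: "integrable lborel h"
    for h :: "real \<Rightarrow> complex" and s a :: real
  proof
    show "integrable lborel (\<lambda>x. exp (\<i> * of_real (a * x)) * h (2 * x - s))"
      using lborel_integrable_real_affine[OF h, of 2 "- s"]
      by (intro integrable_character_mult) simp
    have "(LINT x|lborel. exp (\<i> * of_real (- 2 * pi * y * x)) * h (2 * x - s))
        = \<bar>1/2\<bar> *\<^sub>R (LINT x|lborel. exp (\<i> * of_real (- 2 * pi * y * (s / 2 + 1 / 2 * x)))
             * h (2 * (s / 2 + 1 / 2 * x) - s))"
      by (rule lborel_integral_real_affine) simp
    also have "\<dots> = (1/2) *\<^sub>R (LINT x|lborel. exp (\<i> * of_real (- pi * y * s))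
           * (exp (\<i> * of_real (- 2 * pi * (y / 2) * x)) * h x))"
      by (simp add: algebra_simps add_divide_distrib flip: exp_add)
    also have "\<dots> = exp (\<i> * of_real (- pi * y * s)) * fourier h (y / 2) / 2"
      by (subst integral_mult_right_zero, subst fourier_lborel[OF that(1)]) (simp add: scaleR_conv_of_real)
    finally show "(LINT x|lborel. exp (\<i> * of_real (- 2 * pi * y * x)) * h (2 * x - s)) = \<dots>" .
  qed
  note F = dilate[OF assms(1) int(1), where s = 0, unfolded diff_0_right]
  note G = dilate[OF assms(2) int(2), where s = 1]
  have "fourier (\<lambda>x. f (2 * x) + c * g (2 * x - 1)) y
     = (LINT x|lborel. exp (\<i> * of_real (- 2 * pi * y * x)) * f (2 * x)
          + c * (exp (\<i> * of_real (- 2 * pi * y * x)) * g (2 * x - 1)))"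
    by (subst fourier_lborel) (auto simp: algebra_simps)
  also have "\<dots> = (LINT x|lborel. exp (\<i> * of_real (- 2 * pi * y * x)) * f (2 * x))
          + (LINT x|lborel. c * (exp (\<i> * of_real (- 2 * pi * y * x)) * g (2 * x - 1)))"
    using F[of "- 2 * pi * y"] G[of "- 2 * pi * y"]
    by (intro Bochner_Integration.integral_add Bochner_Integration.integrable_mult_right) auto
  also have "(LINT x|lborel. c * (exp (\<i> * of_real (- 2 * pi * y * x)) * g (2 * x - 1)))
     = c * (LINT x|lborel. exp (\<i> * of_real (- 2 * pi * y * x)) * g (2 * x - 1))"
    by (rule integral_mult_right_zero)
  finally show ?thesis
    unfolding conjunct2[OF F] conjunct2[OF G] by (simp add: algebra_simps add_divide_distrib)
qed

section \<open>Rudin-Shapiro pairs\<close>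

lemma norm_parallelogram_complex:
  fixes a b :: complex
  shows "(norm (a + b))\<^sup>2 + (norm (a - b))\<^sup>2 = 2 * (norm a)\<^sup>2 + 2 * (norm b)\<^sup>2"
  unfolding cmod_power2 by (simp add: power2_eq_square algebra_simps)

text \<open>In each step the phase does not change moduli and the parallelogram law cancels the
  cross terms, so the sum of squares is halved and its argument rescaled by 1/2. Of the
  unimodularity on [0,1), only the domination by the indicator is carried along, as upper bounds on
  the modulus are all that the right-hand side requires.\<close>

lemma rudin_shapiro_pair:
  "\<exists>f g :: real \<Rightarrow> complex.
     f \<in> borel_measurable borel \<and> (\<forall>x. norm (f x) \<le> indicator {0..<1} x) \<and>
     g \<in> borel_measurable borel \<and> (\<forall>x. norm (g x) \<le> indicator {0..<1} x) \<and>
     (\<forall>y. (norm (fourier f y))\<^sup>2 + (norm (fourier g y))\<^sup>2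
        = 2 / 2 ^ k * (norm (fourier (indicator {0..<1}) (y / 2 ^ k)))\<^sup>2)"
proof (induction k)
  case 0
  show ?case
    by (intro exI[of _ "indicator {0..<1}"]) (auto simp: indicator_def)
next
  case (Suc k)
  then obtain f g :: "real \<Rightarrow> complex" where
    f [measurable]: "f \<in> borel_measurable borel" and fb: "\<And>x. norm (f x) \<le> indicator {0..<1} x" and
    g [measurable]: "g \<in> borel_measurable borel" and gb: "\<And>x. norm (g x) \<le> indicator {0..<1} x" and
    S: "\<And>y. (norm (fourier f y))\<^sup>2 + (norm (fourier g y))\<^sup>2
        = 2 / 2 ^ k * (norm (fourier (indicator {0..<1}) (y / 2 ^ k)))\<^sup>2"
    by blast
  define h where "h c x = f (2 * x) + c * g (2 * x - 1)" for c x
  have meas: "h c \<in> borel_measurable borel" for c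
    unfolding h_def by measurable
  have bound: "norm (h c x) \<le> indicator {0..<1} x" if "norm c = 1" for c x
  proof -
    have "norm (h c x) \<le> norm (f (2 * x)) + norm (g (2 * x - 1))"
      unfolding h_def using norm_triangle_ineq[of "f (2 * x)" "c * g (2 * x - 1)"] that
      by (simp add: norm_mult)
    also have "\<dots> \<le> indicator {0..<1} (2 * x) + indicator {0..<1} (2 * x - 1)"
      by (rule add_mono[OF fb gb])
    \<comment> \<open>The half-open intervals [0,1/2) and [1/2,1) partition [0,1); with closed
      intervals the midpoint would be counted twice.\<close>
    also have "\<dots> = (indicator {0..<1} x :: real)"
      by (auto simp: indicator_def)
    finally show ?thesis .
  qed
  have "(norm (fourier (h 1) y))\<^sup>2 + (norm (fourier (h (- 1)) y))\<^sup>2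
      = 2 / 2 ^ Suc k * (norm (fourier (indicator {0..<1}) (y / 2 ^ Suc k)))\<^sup>2" for y
  proof -
    define a b where "a = fourier f (y / 2)" and "b = exp (\<i> * of_real (- pi * y)) * fourier g (y / 2)"
    have nb: "norm b = norm (fourier g (y / 2))"
      unfolding b_def norm_mult norm_exp_i_times by simp
    have h: "fourier (h c) y = (a + c * b) / 2" for c
      unfolding h_def a_def b_def
      using fourier_concat[OF f g integrable_of_bounded_unit_support[OF f fb]
        integrable_of_bounded_unit_support[OF g gb]] by (simp add: mult.assoc)
    have "(norm (fourier (h 1) y))\<^sup>2 + (norm (fourier (h (- 1)) y))\<^sup>2
        = ((norm (a + b))\<^sup>2 + (norm (a - b))\<^sup>2) / 4"
      unfolding h norm_divide power_divide by (simp add: add_divide_distrib[symmetric])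
    also have "\<dots> = ((norm (fourier f (y / 2)))\<^sup>2 + (norm (fourier g (y / 2)))\<^sup>2) / 2"
      unfolding norm_parallelogram_complex nb a_def by (simp add: field_simps)
    finally show ?thesis unfolding S by (simp add: field_simps)
  qed
  then show ?case
    using meas bound[of 1] bound[of "- 1"] by (intro exI[of _ "h 1"] exI[of _ "h (- 1)"]) auto
qed


section \<open>Lower bounds for the transforms and failure of the norm inequality\<close>

text \<open>Here \<open>X\<close> stands for 2^k. The squares add up to at least (2/X)(1/4) =
  1/(2X), so one of them is at least 1/(4X). Which one may depend on \<open>y\<close>, so only the
  sum of the two q-th powers is bounded below. The weight is smallest where |y| + 1 is largest, and
  |y| + 1 is at most 2X.\<close>

lemma fourier_pair_lower_bound:
  fixes f g :: "real \<Rightarrow> complex" and X :: real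
  assumes "0 < q" "1 \<le> X" "\<bar>y\<bar> \<le> X / 16" "\<beta> \<le> 1"
    and S: "(norm (fourier f y))\<^sup>2 + (norm (fourier g y))\<^sup>2
        = 2 / X * (norm (fourier (indicator {0..<1}) (y / X)))\<^sup>2"
  shows "(1 / (4 * X)) powr (q / 2) * (2 * X) powr (\<beta> - 1)
     \<le> norm (fourier f y) powr q * (\<bar>y\<bar> + 1) powr (\<beta> - 1)
       + norm (fourier g y) powr q * (\<bar>y\<bar> + 1) powr (\<beta> - 1)"
proof -
  define a b where "a = norm (fourier f y)" and "b = norm (fourier g y)"
  have "1 / 2 \<le> norm (fourier (indicator {0..<1}) (y / X))"
    using assms by (intro fourier_unit_indicator_ge) (auto simp: field_simps)
  then have "(1 / 2)\<^sup>2 \<le> (norm (fourier (indicator {0..<1}) (y / X)))\<^sup>2"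
    by (intro power_mono) auto
  then have "2 / X * (1 / 2)\<^sup>2 \<le> a\<^sup>2 + b\<^sup>2"
    unfolding S a_def b_def using assms(2) by (intro mult_left_mono) auto
  then have "1 / (2 * X) \<le> a\<^sup>2 + b\<^sup>2" by (simp add: power2_eq_square)
  moreover have "1 / (4 * X) + 1 / (4 * X) = 1 / (2 * X)" using assms(2) by (simp add: field_simps)
  ultimately have "1 / (4 * X) \<le> a\<^sup>2 \<or> 1 / (4 * X) \<le> b\<^sup>2" by linarith
  moreover have "(1 / (4 * X)) powr (q / 2) \<le> t powr q" if "1 / (4 * X) \<le> t\<^sup>2" "0 \<le> t" for t
  proof -
    have "(1 / (4 * X)) powr (q / 2) \<le> (t\<^sup>2) powr (q / 2)"
      using that assms by (intro powr_mono2) auto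
    also have "t\<^sup>2 = t powr 2" using that by simp
    also have "(t powr 2) powr (q / 2) = t powr q" by (simp add: powr_powr)
    finally show ?thesis .
  qed
  ultimately have "(1 / (4 * X)) powr (q / 2) \<le> a powr q + b powr q"
    unfolding a_def b_def by (smt (verit) norm_ge_zero powr_ge_zero)
  moreover have "(2 * X) powr (\<beta> - 1) \<le> (\<bar>y\<bar> + 1) powr (\<beta> - 1)"
    using assms by (intro powr_mono2') auto
  ultimately have "(1 / (4 * X)) powr (q / 2) * (2 * X) powr (\<beta> - 1)
      \<le> (a powr q + b powr q) * (\<bar>y\<bar> + 1) powr (\<beta> - 1)"
    by (intro mult_mono) auto
  then show ?thesis by (simp add: a_def b_def distrib_right)
qed

lemma nn_integral_fourier_pair_lower_bound:
  fixes f g :: "real \<Rightarrow> complex" and X :: real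
  assumes "0 < q" "1 \<le> X" "\<beta> \<le> 1"
    and f: "f \<in> borel_measurable borel" "\<And>x. norm (f x) \<le> indicator {0..<1} x"
    and g: "g \<in> borel_measurable borel" "\<And>x. norm (g x) \<le> indicator {0..<1} x"
    and S: "\<And>y. (norm (fourier f y))\<^sup>2 + (norm (fourier g y))\<^sup>2
        = 2 / X * (norm (fourier (indicator {0..<1}) (y / X)))\<^sup>2"
  shows "ennreal ((1 / 4) powr (q / 2) * 2 powr (\<beta> - 1) / 16 * X powr (\<beta> - q / 2))
     \<le> (\<integral>\<^sup>+y. ennreal (norm (fourier f y) powr q * (\<bar>y\<bar> + 1) powr (\<beta> - 1)) \<partial>lebesgue)
      + (\<integral>\<^sup>+y. ennreal (norm (fourier g y) powr q * (\<bar>y\<bar> + 1) powr (\<beta> - 1)) \<partial>lebesgue)"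
proof -
  define K where "K = (1 / (4 * X)) powr (q / 2) * (2 * X) powr (\<beta> - 1)"
  have meas [measurable]:
    "fourier f \<in> borel_measurable borel" "fourier g \<in> borel_measurable borel"
    by (intro borel_measurable_continuous_onI fourier_continuous_on f g)+
  \<comment> \<open>The growth exponent collects -q/2 from the transforms, \<beta> - 1 from the
    weight, and 1 from the length X/16 of the interval of integration.\<close>
  have "X powr (\<beta> - q / 2) = X powr (- (q / 2) + (\<beta> - 1) + 1)" by simp
  also have "\<dots> = X powr (- (q / 2)) * X powr (\<beta> - 1) * X"
    using assms(2) by (simp only: powr_add powr_one)
  finally have "(1 / 4) powr (q / 2) * 2 powr (\<beta> - 1) / 16 * X powr (\<beta> - q / 2) = K * (X / 16)"
    using assms(2) by (simp add: K_def powr_mult powr_divide powr_minus_divide mult_ac)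
  then have "ennreal ((1 / 4) powr (q / 2) * 2 powr (\<beta> - 1) / 16 * X powr (\<beta> - q / 2))
      = ennreal K * ennreal (X / 16)"
    using assms(2) by (simp only:) (simp add: ennreal_mult K_def del: times_divide_eq_right)
  also have "\<dots> = (\<integral>\<^sup>+y. ennreal K * indicator {0..X / 16} y \<partial>lborel)"
    using assms(2) by (subst nn_integral_cmult_indicator) auto
  also have "\<dots> \<le> (\<integral>\<^sup>+y. ennreal (norm (fourier f y) powr q * (\<bar>y\<bar> + 1) powr (\<beta> - 1))
        + ennreal (norm (fourier g y) powr q * (\<bar>y\<bar> + 1) powr (\<beta> - 1)) \<partial>lborel)"
  proof (rule nn_integral_mono)
    fix y :: real
    show "ennreal K * indicator {0..X / 16} y
      \<le> ennreal (norm (fourier f y) powr q * (\<bar>y\<bar> + 1) powr (\<beta> - 1))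
        + ennreal (norm (fourier g y) powr q * (\<bar>y\<bar> + 1) powr (\<beta> - 1))"
      using fourier_pair_lower_bound[OF assms(1,2) _ assms(3) S, of y]
      by (auto simp: indicator_def K_def ennreal_plus[symmetric] simp del: ennreal_plus intro!: ennreal_leI)
  qed
  also have "\<dots> = (\<integral>\<^sup>+y. ennreal (norm (fourier f y) powr q * (\<bar>y\<bar> + 1) powr (\<beta> - 1)) \<partial>lborel)
      + (\<integral>\<^sup>+y. ennreal (norm (fourier g y) powr q * (\<bar>y\<bar> + 1) powr (\<beta> - 1)) \<partial>lborel)"
    by (rule nn_integral_add) auto
  finally show ?thesis unfolding nn_integral_completion .
qed

text \<open>Since the exponent \<open>\<gamma>\<close> is nonnegative, the weight is at most 1 on
  [0,1); the right-hand side is thus bounded uniformly over all Rudin-Shapiro functions.\<close>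

lemma nn_integral_unit_support_le_1:
  fixes f :: "real \<Rightarrow> complex"
  assumes "\<And>x. norm (f x) \<le> indicator {0..<1} x" "0 < p" "0 \<le> \<gamma>"
  shows "(\<integral>\<^sup>+x. ennreal (norm (f x) powr p * \<bar>x\<bar> powr \<gamma>) \<partial>lebesgue) \<le> 1"
proof -
  have "ennreal (norm (f x) powr p * \<bar>x\<bar> powr \<gamma>) \<le> indicator {0..<1} x" for x
  proof (cases "x \<in> {0..<1}")
    case True
    then have "norm (f x) powr p \<le> 1" "\<bar>x\<bar> powr \<gamma> \<le> 1"
      using assms(1)[of x] assms(2,3) by (auto intro!: powr_le1)
    then have "norm (f x) powr p * \<bar>x\<bar> powr \<gamma> \<le> 1" by (intro mult_le_one) auto
    then show ?thesis using True by (simp add: ennreal_le_1)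
  next
    case False
    then show ?thesis using assms(1)[of x] by simp
  qed
  then have "(\<integral>\<^sup>+x. ennreal (norm (f x) powr p * \<bar>x\<bar> powr \<gamma>) \<partial>lebesgue)
      \<le> (\<integral>\<^sup>+x. indicator {0..<1::real} x \<partial>lebesgue)"
    by (rule nn_integral_mono)
  also have "\<dots> = 1" by simp
  finally show ?thesis .
qed

lemma weighted_fourier_inequality_fails:
  fixes p q \<beta> \<gamma> :: real
  assumes "0 < q" "0 < p" "\<beta> \<le> 1" "q / 2 < \<beta>" "0 \<le> \<gamma>"
  shows "\<not> (\<exists>C::ennreal. C < \<infinity> \<and>
          (\<forall>f::real \<Rightarrow> complex. integrable lebesgue f \<longrightarrow>
            (\<integral>\<^sup>+y. ennreal (norm (fourier f y) powr q * (\<bar>y\<bar> + 1) powr (\<beta> - 1)) \<partial>lebesgue) epowr (1 / q)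
            \<le> C * (\<integral>\<^sup>+x. ennreal (norm (f x) powr p * \<bar>x\<bar> powr \<gamma>) \<partial>lebesgue) epowr (1 / p)))"
proof
  assume "\<exists>C::ennreal. C < \<infinity> \<and>
          (\<forall>f::real \<Rightarrow> complex. integrable lebesgue f \<longrightarrow>
            (\<integral>\<^sup>+y. ennreal (norm (fourier f y) powr q * (\<bar>y\<bar> + 1) powr (\<beta> - 1)) \<partial>lebesgue) epowr (1 / q)
            \<le> C * (\<integral>\<^sup>+x. ennreal (norm (f x) powr p * \<bar>x\<bar> powr \<gamma>) \<partial>lebesgue) epowr (1 / p))"
  then obtain C :: ennreal where "C < \<infinity>" and C: "\<And>f::real \<Rightarrow> complex. integrable lebesgue f \<Longrightarrow>
      (\<integral>\<^sup>+y. ennreal (norm (fourier f y) powr q * (\<bar>y\<bar> + 1) powr (\<beta> - 1)) \<partial>lebesgue) epowr (1 / q)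
      \<le> C * (\<integral>\<^sup>+x. ennreal (norm (f x) powr p * \<bar>x\<bar> powr \<gamma>) \<partial>lebesgue) epowr (1 / p)"
    by blast
  then obtain c where c: "0 \<le> c" "C = ennreal c" by (cases C) auto
  \<comment> \<open>The supposed inequality bounds the left-hand integral by the same number for
    every admissible test function, in particular for both members of every pair.\<close>
  have bound: "(\<integral>\<^sup>+y. ennreal (norm (fourier f y) powr q * (\<bar>y\<bar> + 1) powr (\<beta> - 1)) \<partial>lebesgue)
      \<le> ennreal (c powr q)"
    if "f \<in> borel_measurable borel" "\<And>x. norm (f x) \<le> indicator {0..<1} x" for f :: "real \<Rightarrow> complex"
  proof -
    have "integrable lebesgue f"
      using integrable_of_bounded_unit_support[OF that] that(1) by (simp add: integrable_completion)
    note C[OF this]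
    also have "C * (\<integral>\<^sup>+x. ennreal (norm (f x) powr p * \<bar>x\<bar> powr \<gamma>) \<partial>lebesgue) epowr (1 / p)
        \<le> C * 1 epowr (1 / p)"
      using nn_integral_unit_support_le_1[OF that(2)] assms
      by (intro mult_left_mono epowr_mono) auto
    also have "C * 1 epowr (1 / p) = ennreal c"
      using c by (simp add: epowr_def)
    finally show ?thesis
      using le_of_epowr_le[of "1 / q" c] assms(1) c(1) by simp
  qed
  define D \<delta> where "D = (1 / 4 :: real) powr (q / 2) * 2 powr (\<beta> - 1) / 16" and "\<delta> = \<beta> - q / 2"
  have pos: "0 < D" "0 < \<delta>" using assms by (auto simp: D_def \<delta>_def)
  \<comment> \<open>The two uniform bounds add up to \<open>2 * c powr q\<close>, which would force
    \<open>(2 ^ k) powr \<delta>\<close> to be at most \<open>M\<close>; \<open>k\<close> is then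
    chosen to violate this.\<close>
  define M where "M = 2 * c powr q / D"
  have "0 \<le> M" using pos by (simp add: M_def)
  obtain k where k: "M powr (1 / \<delta>) < 2 ^ k"
    using real_arch_pow[of 2 "M powr (1 / \<delta>)"] by auto
  obtain f g :: "real \<Rightarrow> complex" where
    f: "f \<in> borel_measurable borel" "\<And>x. norm (f x) \<le> indicator {0..<1} x" and
    g: "g \<in> borel_measurable borel" "\<And>x. norm (g x) \<le> indicator {0..<1} x" and
    S: "\<And>y. (norm (fourier f y))\<^sup>2 + (norm (fourier g y))\<^sup>2
        = 2 / 2 ^ k * (norm (fourier (indicator {0..<1}) (y / 2 ^ k)))\<^sup>2"
    using rudin_shapiro_pair[of k] by blast
  have "ennreal (D * (2 ^ k) powr \<delta>) \<le> ennreal (c powr q) + ennreal (c powr q)"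
    unfolding D_def \<delta>_def
    by (rule order_trans[OF nn_integral_fourier_pair_lower_bound[OF assms(1) _ assms(3) f g S]])
       (auto intro!: add_mono bound f g)
  also have "\<dots> = ennreal (2 * c powr q)"
    by (simp flip: ennreal_plus)
  finally have "(2 ^ k) powr \<delta> \<le> M"
    using pos by (simp add: M_def field_simps)
  moreover have "(M powr (1 / \<delta>)) powr \<delta> < (2 ^ k) powr \<delta>"
    using pos k by (intro powr_less_mono2) auto
  ultimately show False
    using pos \<open>0 \<le> M\<close> by (simp add: powr_powr)
qed

theorem mainTheorem6:
  fixes p q r p' \<alpha> \<beta> :: real
    and U W :: "real \<Rightarrow> real"
    and u w :: "real \<Rightarrow> ennreal"
  assumes "1 < q" "q < 2" "2 < p"
    and "1 / r = 1 / q - 1 / p"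
    and "1 / p + 1 / p' = 1"
    and "\<alpha> \<in> {0<..<1}" "\<beta> \<in> {0<..<1}"
    and "1 / 2 < \<beta> / q" "\<beta> / q < \<alpha> / p'" "\<alpha> / p' < 1 / q" "1 / q < 1"
    and "\<And>y. U y = (\<bar>y\<bar> + 1) powr (\<beta> - 1)"
    and "\<And>x. W x = \<bar>x\<bar> powr ((1 - \<alpha>) * (p - 1))"
    and "\<And>t. t > 0 \<Longrightarrow> u t = rearrangement U t"
    and "\<And>t. t > 0 \<Longrightarrow> 1 / w t = rearrangement (\<lambda>x. 1 / W x) t"
  shows "(\<integral>\<^sup>+x\<in>{0<..}.
             (\<integral>\<^sup>+t\<in>{0<..<x}. u t \<partial>lebesgue) epowr (r / p) *
             (\<integral>\<^sup>+t\<in>{0<..<1 / x}. (w t) epowr (1 - p') \<partial>lebesgue) epowr (r / p') *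
             u x \<partial>lebesgue) epowr (1 / r) < \<infinity>
    \<and> \<not> (\<exists>C::ennreal. C < \<infinity> \<and>
          (\<forall>f::real \<Rightarrow> complex. integrable lebesgue f \<longrightarrow>
            (\<integral>\<^sup>+y. ennreal (norm (fourier f y) powr q * U y) \<partial>lebesgue) epowr (1 / q)
            \<le> C * (\<integral>\<^sup>+x. ennreal (norm (f x) powr p * W x) \<partial>lebesgue) epowr (1 / p)))"
proof
  have U: "U = (\<lambda>y. (\<bar>y\<bar> + 1) powr (\<beta> - 1))" and W: "W = (\<lambda>x. \<bar>x\<bar> powr ((1 - \<alpha>) * (p - 1)))"
    using assms by auto
  \<comment> \<open>Positivity of \<open>1 / r\<close> matters for the outer power: with a negative
    exponent, \<open>epowr\<close> would send 0 to infinity.\<close>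
  have "1 / p < 1 / q" using assms(1-3) by (intro divide_strict_left_mono) auto
  then have r: "0 < 1 / r" using assms(4) by simp
  have "(\<integral>\<^sup>+x\<in>{0<..}.
             (\<integral>\<^sup>+t\<in>{0<..<x}. u t \<partial>lebesgue) epowr (r / p) *
             (\<integral>\<^sup>+t\<in>{0<..<1 / x}. (w t) epowr (1 - p') \<partial>lebesgue) epowr (r / p') *
             u x \<partial>lebesgue) < \<infinity>"
    using assms(1-7) by (intro rearrangement_integral_finite[OF _ _ _ assms(4,5) _ _ _ _ assms(9,10)
      assms(14)[unfolded U] assms(15)[unfolded W]]) auto
  then show "(\<integral>\<^sup>+x\<in>{0<..}.
             (\<integral>\<^sup>+t\<in>{0<..<x}. u t \<partial>lebesgue) epowr (r / p) *
             (\<integral>\<^sup>+t\<in>{0<..<1 / x}. (w t) epowr (1 - p') \<partial>lebesgue) epowr (r / p') *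
             u x \<partial>lebesgue) epowr (1 / r) < \<infinity>"
    by (rule epowr_less_top[OF r])
  have "q / 2 < \<beta>" using assms(1,8) by (simp add: field_simps)
  then show "\<not> (\<exists>C::ennreal. C < \<infinity> \<and>
          (\<forall>f::real \<Rightarrow> complex. integrable lebesgue f \<longrightarrow>
            (\<integral>\<^sup>+y. ennreal (norm (fourier f y) powr q * U y) \<partial>lebesgue) epowr (1 / q)
            \<le> C * (\<integral>\<^sup>+x. ennreal (norm (f x) powr p * W x) \<partial>lebesgue) epowr (1 / p)))"
    unfolding U W using assms(1,3,6,7) by (intro weighted_fourier_inequality_fails) auto
qed

end
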